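(* The quantum configuration whose observables are all the 63 points of $W_3$ and whose contexts are all the 315 lines of $W_3$ is contextual, and its contextuality degree is $63$.
   Context: $W_N=\mathcal{W}(2N-1,2)$ is the symplectic polar space on $\mathbb{F}_2^{2N}$ with symplectic form $\langle x|y\rangle=\sum_{i=1}^N (x_iy_{N+i}+x_{N+i}y_i)$; here $N=3$. Its points are the nonzero vectors of $\mathbb{F}_2^{2N}$; its lines are the sets $\{a,b,a+b\}$ with $a\neq b$ nonzero and $\langle a|b\rangle=0$. Let $I$ be the $2\times2$ identity matrix and $X=\begin{pmatrix}0&1\\1&0\end{pmatrix}$, $Y=\begin{pmatrix}0&-\mathrm{i}\\ \mathrm{i}&0\end{pmatrix}$, $Z=\begin{pmatrix}1&0\\0&-1\end{pmatrix}$. A point $(g_1,\dots,g_{2N})$ is identified with the (phase-free) $N$-qubit observable $G_1\otimes\cdots\otimes G_N$, $G_j\in\{I,X,Y,Z\}$, where $(g_j,g_{j+N})=(0,0),(0,1),(1,1),(1,0)$ corresponds to $G_j=I,X,Y,Z$ respectively. Two observables commute iff their vectors are orthogonal for the symplectic form. A quantum configuration is a pair $(O,C)$, with $O$ a finite set of observables and $C$ a finite set of subsets of $O$ (contexts), such that each $M\in O$ satisfies $M^2=I^{\otimes N}$, observables in the same context commute, and the matrix product of all observables of each context is $I^{\otimes N}$ (positive context) or $-I^{\otimes N}$ (negative context). Its incidence matrix $A\in\mathbb{F}_2^{|C|\times|O|}$ has $A_{i,j}=1$ iff the $i$-th context contains the $j$-th observable; its valuation vector $E\in\mathbb{F}_2^{|C|}$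 has $E_i=0$ if the $i$-th context is positive and $E_i=1$ if it is negative. The configuration is contextual iff $Ax=E$ has no solution $x\in\mathbb{F}_2^{|O|}$; its contextuality degree is then $d=d_H(E,\mathrm{Im}(A))$, the minimal Hamming distance from $E$ to a vector of the image of $A:\mathbb{F}_2^{|O|}\to\mathbb{F}_2^{|C|}$. *)

theory Defs
  imports "Jordan_Normal_Form.Matrix" "HOL-Library.Z2" "HOL-Library.FuncSet"
begin

text \<open>Coordinates are numbered from 0, so the pairs \<open>(i, N + i)\<close> below have \<open>i < N\<close>.\<close>

definition symp_form :: "nat \<Rightarrow> bit vec \<Rightarrow> bit vec \<Rightarrow> bit" where
  "symp_form N x y = (\<Sum>i<N. x $ i * y $ (N + i) + x $ (N + i) * y $ i)"

definition W_points :: "nat \<Rightarrow> bit vec set" where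
  "W_points N = {v \<in> carrier_vec (2 * N). v \<noteq> 0\<^sub>v (2 * N)}"

definition W_lines :: "nat \<Rightarrow> bit vec set set" where
  "W_lines N =
     {{a, b, a + b} | a b. a \<in> W_points N \<and> b \<in> W_points N \<and> a \<noteq> b \<and> symp_form N a b = 0}"

definition pauli_X :: "complex mat" where
  "pauli_X = mat_of_rows_list 2 [[0, 1], [1, 0]]"

definition pauli_Y :: "complex mat" where
  "pauli_Y = mat_of_rows_list 2 [[0, - \<i>], [\<i>, 0]]"

definition pauli_Z :: "complex mat" where
  "pauli_Z = mat_of_rows_list 2 [[1, 0], [0, - 1]]"

definition pauli :: "bit \<Rightarrow> bit \<Rightarrow> complex mat" where
  "pauli u v =
     (if u = 0 then (if v = 0 then 1\<^sub>m 2 else pauli_X)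
      else (if v = 0 then pauli_Z else pauli_Y))"

definition kronecker :: "complex mat \<Rightarrow> complex mat \<Rightarrow> complex mat" where
  "kronecker A B = mat (dim_row A * dim_row B) (dim_col A * dim_col B)
     (\<lambda>(i, j). A $$ (i div dim_row B, j div dim_col B) * B $$ (i mod dim_row B, j mod dim_col B))"

definition kronecker_list :: "complex mat list \<Rightarrow> complex mat" where
  "kronecker_list Gs = foldr kronecker Gs (1\<^sub>m 1)"

definition observable_of :: "nat \<Rightarrow> bit vec \<Rightarrow> complex mat" where
  "observable_of N g = kronecker_list (map (\<lambda>j. pauli (g $ j) (g $ (j + N))) [0..<N])"

definition qubit_observables :: "nat \<Rightarrow> complex mat set" where
  "qubit_observables N = observable_of N ` carrier_vec (2 * N)"

text \<open>The product of a finite set of matrices is taken along every duplicate-free enumeration; for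
  the pairwise commuting observables of a context all these products agree.\<close>

definition has_product :: "nat \<Rightarrow> complex mat set \<Rightarrow> complex mat \<Rightarrow> bool" where
  "has_product N c P \<longleftrightarrow>
     finite c \<and> (\<forall>Ms. distinct Ms \<and> set Ms = c \<longrightarrow> foldr (*) Ms (1\<^sub>m (2 ^ N)) = P)"

definition positive_context :: "nat \<Rightarrow> complex mat set \<Rightarrow> bool" where
  "positive_context N c \<longleftrightarrow> has_product N c (1\<^sub>m (2 ^ N))"

definition negative_context :: "nat \<Rightarrow> complex mat set \<Rightarrow> bool" where
  "negative_context N c \<longleftrightarrow> has_product N c (- 1\<^sub>m (2 ^ N))"

definition quantum_configuration ::
    "nat \<Rightarrow> complex mat set \<Rightarrow> complex mat set set \<Rightarrow> bool" where
  "quantum_configuration N Obs C \<longleftrightarrow>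
     finite Obs \<and> Obs \<subseteq> qubit_observables N \<and>
     finite C \<and> (\<forall>c\<in>C. c \<subseteq> Obs) \<and>
     (\<forall>M\<in>Obs. M * M = 1\<^sub>m (2 ^ N)) \<and>
     (\<forall>c\<in>C. \<forall>M\<in>c. \<forall>M'\<in>c. M * M' = M' * M) \<and>
     (\<forall>c\<in>C. positive_context N c \<or> negative_context N c)"

text \<open>Rows and columns are indexed by the contexts and observables themselves instead of by
  numberings of them: vectors over \<open>Obs\<close> are the elements of \<open>Obs \<rightarrow>\<^sub>E UNIV\<close>, and similarly
  for \<open>C\<close>.\<close>

definition incidence_matrix :: "complex mat set \<Rightarrow> complex mat \<Rightarrow> bit" where
  "incidence_matrix c M = (if M \<in> c then 1 else 0)"

definition incidence_map ::
    "complex mat set \<Rightarrow> complex mat set set \<Rightarrow> (complex mat \<Rightarrow> bit) \<Rightarrow> (complex mat set \<Rightarrow> bit)"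
  where
  "incidence_map Obs C x = (\<lambda>c\<in>C. \<Sum>M\<in>Obs. incidence_matrix c M * x M)"

definition valuation_vector ::
    "nat \<Rightarrow> complex mat set set \<Rightarrow> (complex mat set \<Rightarrow> bit)" where
  "valuation_vector N C = (\<lambda>c\<in>C. if negative_context N c then 1 else 0)"

definition contextual :: "nat \<Rightarrow> complex mat set \<Rightarrow> complex mat set set \<Rightarrow> bool" where
  "contextual N Obs C \<longleftrightarrow>
     \<not> (\<exists>x \<in> Obs \<rightarrow>\<^sub>E UNIV. incidence_map Obs C x = valuation_vector N C)"

definition hamming_distance :: "'a set \<Rightarrow> ('a \<Rightarrow> bit) \<Rightarrow> ('a \<Rightarrow> bit) \<Rightarrow> nat" where
  "hamming_distance I u v = card {i \<in> I. u i \<noteq> v i}"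

definition contextuality_degree ::
    "nat \<Rightarrow> complex mat set \<Rightarrow> complex mat set set \<Rightarrow> nat" where
  "contextuality_degree N Obs C =
     (LEAST d. \<exists>v \<in> incidence_map Obs C ` (Obs \<rightarrow>\<^sub>E UNIV).
        d = hamming_distance C (valuation_vector N C) v)"

definition W_observables :: "nat \<Rightarrow> complex mat set" where
  "W_observables N = observable_of N ` W_points N"

definition W_contexts :: "nat \<Rightarrow> complex mat set set" where
  "W_contexts N = (\<lambda>l. observable_of N ` l) ` W_lines N"

end

theory Submission
  imports Defs "HOL-Library.Product_Plus"
begin

text \<open>
  An assignment of signs to the observables violates at least one of the six lines of every Mermin
  square, because the phases of these lines multiply to \<open>-1\<close>. A doily (the \<open>15\<close> lines spanned by
  two orthogonal hyperbolic pairs) contains ten Mermin squares, four through each line, so at least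
  \<open>10 / 4\<close>, that is three, of its lines are violated. Averaging over all doilies, at least a fifth of the
  \<open>315\<close> lines are violated. Instead of doilies we sum over the frames \<open>(a, b, c, d)\<close> spanning them: for
  each of the \<open>15\<close> lines some permutation of the set of frames sends that line to \<open>{a, c, a + c}\<close>, and
  every ordered pair \<open>(a, c)\<close> of orthogonal points extends to equally many frames.
  An explicit assignment with \<open>63\<close> violated lines shows that the bound is attained.
\<close>

section \<open>Frames of a symplectic space in characteristic two\<close>

text \<open>\<open>t\<close> maps each of the two halves of \<open>S\<close> injectively into the
  other, so finiteness gives them equal size.\<close>

lemma card_halved_by_flip:
  assumes "finite S" "\<And>x. x \<in> S \<Longrightarrow> t x \<in> S" "inj t" "\<And>x. x \<in> S \<Longrightarrow> P (t x) \<longleftrightarrow> \<not> P x"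
  shows "card S = 2 * card {x \<in> S. P x}"
proof -
  let ?A = "{x \<in> S. P x}" and ?B = "{x \<in> S. \<not> P x}"
  have "t ` ?A \<subseteq> ?B" "t ` ?B \<subseteq> ?A" using assms(2,4) by auto
  then have "card ?A \<le> card ?B" "card ?B \<le> card ?A"
    using assms(1) by (simp_all add: card_inj_on_le[OF inj_on_subset[OF assms(3)]])
  moreover have "card S = card ?A + card ?B"
    using card_Int_Diff[OF assms(1), of "Collect P"] by (simp add: Int_def set_diff_eq)
  ultimately show ?thesis by simp
qed

text \<open>The space over the field with two elements is kept as a finite abelian group of exponent
  two and the form as a predicate, so that adding form values becomes \<open>\<noteq>\<close> on
  booleans.\<close>

locale symplectic_space =
  fixes \<omega> :: "'v::{finite, ab_group_add} \<Rightarrow> 'v \<Rightarrow> bool"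
  assumes double: "(x :: 'v) + x = 0"
    and \<omega>_commute: "\<omega> x y \<longleftrightarrow> \<omega> y x"
    and \<omega>_add_left: "\<omega> (x + y) z \<longleftrightarrow> \<omega> x z \<noteq> \<omega> y z"
    and \<omega>_self: "\<not> \<omega> x x"
    and nondegenerate: "x \<noteq> 0 \<Longrightarrow> \<exists>y. \<omega> x y"
begin

lemma double_left: "(x :: 'v) + (x + y) = y"
  by (simp add: double flip: add.assoc)

lemma add_eq_0_iff_eq: "(x :: 'v) + y = 0 \<longleftrightarrow> x = y"
  by (metis add_0_right double double_left)

lemmas char2_simps = double double_left add_eq_0_iff_eq add.assoc add.commute add.left_commute

lemma \<omega>_add_right: "\<omega> z (x + y) \<longleftrightarrow> \<omega> z x \<noteq> \<omega> z y"
  by (simp add: \<omega>_commute[of z] \<omega>_add_left)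

lemma \<omega>_0: "\<not> \<omega> 0 x" "\<not> \<omega> x 0"
  using \<omega>_add_left[of 0 0 x] \<omega>_commute[of x 0] by auto

lemmas \<omega>_simps = \<omega>_add_left \<omega>_add_right \<omega>_self \<omega>_0

definition orthogonal_pairs :: "('v \<times> 'v) set" where
  "orthogonal_pairs = {(a, c). a \<noteq> 0 \<and> c \<noteq> 0 \<and> a \<noteq> c \<and> \<not> \<omega> a c}"

text \<open>Two mutually orthogonal hyperbolic pairs \<open>(a, b)\<close> and
  \<open>(c, d)\<close>; the six form values force the four vectors to be linearly
  independent.\<close>

definition frames :: "('v \<times> 'v \<times> 'v \<times> 'v) set" where
  "frames = {(a, b, c, d). \<omega> a b \<and> \<omega> c d \<and> \<not> \<omega> a c \<and> \<not> \<omega> a d \<and> \<not> \<omega> b c \<and> \<not> \<omega> b d}"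

lemma frameD:
  assumes "(a, b, c, d) \<in> frames"
  shows "\<omega> a b" "\<omega> b a" "\<omega> c d" "\<omega> d c" "\<not> \<omega> a c" "\<not> \<omega> c a" "\<not> \<omega> a d" "\<not> \<omega> d a"
    "\<not> \<omega> b c" "\<not> \<omega> c b" "\<not> \<omega> b d" "\<not> \<omega> d b"
  using assms by (simp_all add: frames_def \<omega>_commute[of b a] \<omega>_commute[of d c] \<omega>_commute[of c a]
      \<omega>_commute[of c b] \<omega>_commute[of d a] \<omega>_commute[of d b])

lemma frameI:
  assumes "\<omega> a b" "\<omega> c d" "\<not> \<omega> a c" "\<not> \<omega> a d" "\<not> \<omega> b c" "\<not> \<omega> b d"
  shows "(a, b, c, d) \<in> frames"
  using assms by (simp add: frames_def)

text \<open>Both \<open>a\<close> and \<open>a + c\<close> are nonzero, so nondegeneracy gives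
  \<open>f\<close> for the first and \<open>g\<close> for the second; one of \<open>f\<close>,
  \<open>g\<close>, \<open>f + g\<close> then tells \<open>a\<close> from \<open>c\<close> as
  required.\<close>

lemma orthogonal_pairs_separated:
  assumes "(a, c) \<in> orthogonal_pairs"
  shows "\<exists>e. \<omega> a e \<and> \<not> \<omega> c e"
proof -
  obtain f where f: "\<omega> a f"
    using assms nondegenerate by (auto simp: orthogonal_pairs_def)
  obtain g where g: "\<omega> (a + c) g"
    using assms nondegenerate[of "a + c"] by (auto simp: orthogonal_pairs_def add_eq_0_iff_eq)
  then have "\<omega> a f \<and> \<not> \<omega> c f \<or> \<omega> a g \<and> \<not> \<omega> c g \<or> \<omega> a (f + g) \<and> \<not> \<omega> c (f + g)"
    using f by (auto simp: \<omega>_simps)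
  then show ?thesis by blast
qed

lemma orthogonal_pairsD:
  assumes "(a, c) \<in> orthogonal_pairs"
  shows "a \<noteq> 0" "c \<noteq> 0" "a \<noteq> c" "\<not> \<omega> a c" "\<not> \<omega> c a"
    "a + c \<noteq> 0" "a + c \<noteq> a" "a + c \<noteq> c"
  using assms \<omega>_commute[of a c] by (auto simp: orthogonal_pairs_def add_eq_0_iff_eq)

lemma orthogonal_pairs_swap:
  "(a, c) \<in> orthogonal_pairs \<Longrightarrow> (c, a) \<in> orthogonal_pairs"
  using \<omega>_commute[of a c] by (auto simp: orthogonal_pairs_def)

section \<open>Counting orthogonal pairs and the frames over them\<close>

lemma card_not_orthogonal:
  assumes "a \<noteq> 0"
  shows "2 * card {x. \<not> \<omega> a x} = card (UNIV :: 'v set)"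
proof -
  obtain e where "\<omega> a e" using nondegenerate[OF assms] by blast
  then show ?thesis
    using card_halved_by_flip[of UNIV "\<lambda>x. x + e" "\<lambda>x. \<not> \<omega> a x"]
    by (simp add: \<omega>_simps inj_def)
qed

text \<open>With \<open>q\<close> vectors in all there are \<open>q - 1\<close> choices of
  \<open>a\<close>; the hyperplane orthogonal to \<open>a\<close> has \<open>q / 2\<close> elements,
  from which \<open>0\<close> and \<open>a\<close> are removed.\<close>

lemma card_orthogonal_pairs:
  "2 * card orthogonal_pairs = (card (UNIV :: 'v set) - 1) * (card (UNIV :: 'v set) - 4)"
proof -
  have "orthogonal_pairs = (SIGMA a:UNIV - {0}. {x. \<not> \<omega> a x} - {0, a})"
    by (auto simp: orthogonal_pairs_def)
  moreover have "2 * card ({x. \<not> \<omega> a x} - {0, a}) = card (UNIV :: 'v set) - 4" if "a \<noteq> 0" for a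
    using card_not_orthogonal[OF that] that
    by (subst card_Diff_subset) (auto simp: \<omega>_simps)
  ultimately show ?thesis
    by (simp add: sum_distrib_left card_Diff_subset)
qed

text \<open>Once \<open>(a, c)\<close> is fixed, five binary conditions on \<open>(b, d)\<close>
  remain, and each of them halves the set of all \<open>q^2\<close> pairs.\<close>

lemma card_frames_over:
  assumes "(a, c) \<in> orthogonal_pairs"
  shows "32 * card {(b, d). (a, b, c, d) \<in> frames} = (card (UNIV :: 'v set))\<^sup>2"
proof -
  obtain e where e: "\<omega> a e" "\<not> \<omega> c e"
    using orthogonal_pairs_separated[OF assms] by blast
  obtain e' where e': "\<omega> c e'" "\<not> \<omega> a e'"
    using orthogonal_pairs_separated[OF orthogonal_pairs_swap[OF assms]] by blast
  have ac: "\<not> \<omega> a c" "\<not> \<omega> c a"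
    using assms \<omega>_commute[of a c] by (auto simp: orthogonal_pairs_def)
  \<comment> \<open>Each translation below flips the newest condition and preserves the earlier
    ones: of \<open>a\<close> and \<open>c\<close>, the vector \<open>e\<close> pairs only with
    \<open>a\<close> and \<open>e'\<close> only with \<open>c\<close>. The last shift, of
    \<open>d\<close> by \<open>a\<close>, flips \<open>\<omega> b d\<close> because
    \<open>\<omega> a b\<close> holds.\<close>
  let ?S1 = "{p :: 'v \<times> 'v. \<omega> a (fst p)}"
  let ?S2 = "{p \<in> ?S1. \<not> \<omega> c (fst p)}"
  let ?S3 = "{p \<in> ?S2. \<omega> c (snd p)}"
  let ?S4 = "{p \<in> ?S3. \<not> \<omega> a (snd p)}"
  let ?S5 = "{p \<in> ?S4. \<not> \<omega> (fst p) (snd p)}"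
  have "card (UNIV :: ('v \<times> 'v) set) = 2 * card ?S1"
    using card_halved_by_flip[of UNIV "\<lambda>p :: 'v \<times> 'v. (fst p + e, snd p)" "\<lambda>p. \<omega> a (fst p)"] e
    by (simp add: \<omega>_simps inj_def prod_eq_iff)
  moreover have "card ?S1 = 2 * card ?S2"
    by (rule card_halved_by_flip[where t = "\<lambda>p. (fst p + e', snd p)"])
      (use e' in \<open>auto simp: \<omega>_simps inj_def prod_eq_iff\<close>)
  moreover have "card ?S2 = 2 * card ?S3"
    by (rule card_halved_by_flip[where t = "\<lambda>p. (fst p, snd p + e')"])
      (use e' in \<open>auto simp: \<omega>_simps inj_def prod_eq_iff\<close>)
  moreover have "card ?S3 = 2 * card ?S4"
    by (rule card_halved_by_flip[where t = "\<lambda>p. (fst p, snd p + e)"])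
      (use e in \<open>auto simp: \<omega>_simps inj_def prod_eq_iff\<close>)
  moreover have "card ?S4 = 2 * card ?S5"
    by (rule card_halved_by_flip[where t = "\<lambda>p. (fst p, snd p + a)"])
      (use ac in \<open>auto simp: \<omega>_simps \<omega>_commute[of _ a] inj_def prod_eq_iff\<close>)
  moreover have "?S5 = {(b, d). (a, b, c, d) \<in> frames}"
    using ac by (auto simp: \<omega>_commute[of _ c] intro: frameI dest: frameD)
  moreover have "card (UNIV :: ('v \<times> 'v) set) = (card (UNIV :: 'v set))\<^sup>2"
    by (simp add: card_cartesian_product power2_eq_square flip: UNIV_Times_UNIV)
  ultimately show ?thesis by simp
qed

text \<open>All fibres of the projection to \<open>(a, c)\<close> have size \<open>q^2 / 32\<close>,
  so a summand that depends only on \<open>(a, c)\<close> is counted that many times.\<close>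

lemma sum_over_frames:
  fixes g :: "'v \<Rightarrow> 'v \<Rightarrow> nat"
  shows "32 * (\<Sum>(a, b, c, d)\<in>frames. g a c) =
    (card (UNIV :: 'v set))\<^sup>2 * (\<Sum>(a, c)\<in>orthogonal_pairs. g a c)"
proof -
  have sub: "(a, c) \<in> orthogonal_pairs" if "(a, b, c, d) \<in> frames" for a b c d
    using frameD[OF that] by (auto simp: orthogonal_pairs_def \<omega>_simps)
  have "(\<Sum>(a, b, c, d)\<in>frames. g a c) =
      (\<Sum>((a, c), (b, d)) \<in> (SIGMA (a, c):orthogonal_pairs. {(b, d). (a, b, c, d) \<in> frames}). g a c)"
    by (rule sum.reindex_bij_witness[of _ "\<lambda>((a, c), (b, d)). (a, b, c, d)"
          "\<lambda>(a, b, c, d). ((a, c), (b, d))"]) (auto dest: sub)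
  also have "\<dots> = (\<Sum>(a, c)\<in>orthogonal_pairs. card {(b, d). (a, b, c, d) \<in> frames} * g a c)"
    by (subst sum.Sigma[symmetric]) (auto simp: case_prod_unfold)
  finally have "32 * (\<Sum>(a, b, c, d)\<in>frames. g a c) =
      (\<Sum>(a, c)\<in>orthogonal_pairs. 32 * card {(b, d). (a, b, c, d) \<in> frames} * g a c)"
    by (simp add: sum_distrib_left case_prod_unfold mult.assoc)
  also have "\<dots> = (\<Sum>(a, c)\<in>orthogonal_pairs. (card (UNIV :: 'v set))\<^sup>2 * g a c)"
    by (rule sum.cong) (auto simp: card_frames_over)
  finally show ?thesis by (simp add: sum_distrib_left case_prod_unfold)
qed

text \<open>An injective self-map of the finite set \<open>frames\<close> is a permutation, so
  reindexing preserves the sum. \<open>p'\<close> and \<open>q'\<close> complete \<open>p\<close>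
  and \<open>q\<close> to a frame.\<close>

lemma sum_frames_transform:
  fixes g :: "'v \<Rightarrow> 'v \<Rightarrow> nat"
  assumes "\<And>a b c d. (a, b, c, d) \<in> frames \<Longrightarrow>
      (p a b c d, p' a b c d, q a b c d, q' a b c d) \<in> frames"
    and "inj (\<lambda>(a, b, c, d). (p a b c d, p' a b c d, q a b c d, q' a b c d))"
  shows "(\<Sum>(a, b, c, d)\<in>frames. g (p a b c d) (q a b c d)) = (\<Sum>(a, b, c, d)\<in>frames. g a c)"
proof -
  let ?t = "\<lambda>(a, b, c, d). (p a b c d, p' a b c d, q a b c d, q' a b c d)"
  have "?t ` frames = frames"
    using assms by (intro endo_inj_surj) (auto intro: inj_on_subset)
  then have "bij_betw ?t frames frames"
    using assms(2) by (auto simp: bij_betw_def intro: inj_on_subset)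
  from sum.reindex_bij_betw[OF this, of "\<lambda>(a, b, c, d). g a c"] show ?thesis
    by (simp add: case_prod_unfold)
qed

section \<open>Lines and the ordered pairs that span them\<close>

definition lines :: "'v set set" where
  "lines = (\<lambda>(a, c). {a, c, a + c}) ` orthogonal_pairs"

lemma in_lines_iff: "l \<in> lines \<longleftrightarrow> (\<exists>a c. (a, c) \<in> orthogonal_pairs \<and> l = {a, c, a + c})"
  by (auto simp: lines_def)

lemma bex_lines_iff: "(\<exists>l\<in>lines. P l) \<longleftrightarrow> (\<exists>a c. (a, c) \<in> orthogonal_pairs \<and> P {a, c, a + c})"
  unfolding Bex_def in_lines_iff by blast

text \<open>A line has three points, any two of which span it, and so arises from exactly six
  ordered pairs.\<close>

lemma card_orthogonal_pairs_filter:
  "card {(a, c) \<in> orthogonal_pairs. P {a, c, a + c}} = 6 * card {l \<in> lines. P l}"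
proof -
  let ?l = "\<lambda>(a, c). {a, c, a + c}"
  let ?T = "{p \<in> orthogonal_pairs. P (?l p)}"
  have fibre: "card {p \<in> ?T. ?l p = l} = 6" if l: "l \<in> {l \<in> lines. P l}" for l
  proof -
    from l obtain a c where ac: "(a, c) \<in> orthogonal_pairs" and l: "l = {a, c, a + c}" "P l"
      by (auto simp: lines_def)
    note ne = orthogonal_pairsD[OF ac] orthogonal_pairsD(7,8)[OF ac, symmetric]
    have "{p \<in> ?T. ?l p = l} = {(a, c), (c, a), (a, a + c), (a + c, a), (c, a + c), (a + c, c)}"
      (is "?A = ?B")
    proof
      show "?A \<subseteq> ?B"
      proof
        fix p assume p: "p \<in> ?A"
        then obtain x y where xy: "p = (x, y)" "x \<noteq> y" "{x, y, x + y} = {a, c, a + c}"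
          by (auto simp: l orthogonal_pairs_def)
        then have "x \<in> {a, c, a + c}" "y \<in> {a, c, a + c}" by blast+
        with xy(1,2) show "p \<in> ?B" by blast
      qed
      have "?l p = l" if "p \<in> ?B" for p
        using that by (auto simp: l char2_simps)
      moreover have "p \<in> orthogonal_pairs" if "p \<in> ?B" for p
        using that ne by (auto simp: orthogonal_pairs_def \<omega>_simps)
      ultimately show "?B \<subseteq> ?A" using l(2) by blast
    qed
    then show ?thesis using ne by simp
  qed
  have "card ?T = (\<Sum>l\<in>{l \<in> lines. P l}. card {p \<in> ?T. ?l p = l})"
    using sum.group[of ?T "{l \<in> lines. P l}" ?l "\<lambda>_. 1 :: nat"] by (force simp: lines_def)
  then show ?thesis using fibre by (simp add: case_prod_unfold)
qed

end

section \<open>Mermin squares and doilies\<close>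

text \<open>\<open>\<phi> x y\<close> models the scalar by which the product of the observables of
  \<open>x\<close> and \<open>y\<close> differs from the observable of \<open>x + y\<close>. The
  cocycle law is associativity, and \<open>phase_swap\<close> says that the form records
  anticommutation.\<close>

locale pauli_phase = symplectic_space \<omega> for \<omega> :: "'v::{finite, ab_group_add} \<Rightarrow> 'v \<Rightarrow> bool" +
  fixes \<phi> :: "'v \<Rightarrow> 'v \<Rightarrow> complex"
  assumes cocycle: "\<phi> x y * \<phi> (x + y) z = \<phi> y z * \<phi> x (y + z)"
    and phase_swap: "\<phi> x y = (if \<omega> x y then - 1 else 1) * \<phi> y x"
    and phase_self: "\<phi> x x = 1"
    and phase_0: "\<phi> 0 x = 1"
    and phase_real: "\<not> \<omega> x y \<Longrightarrow> \<phi> x y = 1 \<or> \<phi> x y = - 1"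
begin

lemma phase_commute: "\<not> \<omega> x y \<Longrightarrow> \<phi> x y = \<phi> y x"
  by (simp add: phase_swap[of x y])

text \<open>The cocycle law for \<open>x\<close>, \<open>x\<close>, \<open>y\<close> says that the
  two phases multiply to 1, and \<open>\<phi> x y\<close> is a sign. Together with
  \<open>phase_commute\<close> this gives every ordered pair of points on a line the same
  sign.\<close>

lemma phase_add_right: "\<not> \<omega> x y \<Longrightarrow> \<phi> x (x + y) = \<phi> x y"
  using cocycle[of x x y] phase_real[of x y] by (auto simp: phase_self phase_0 double minus_equation_iff)

text \<open>The two sides are the scalars of the bracketed products \<open>(a c) (d b)\<close> and
  \<open>(a d) (c b)\<close>; passing from one to the other swaps the anticommuting \<open>c\<close>
  and \<open>d\<close>. The six phases belong to the rows and columns of the Mermin square with rows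
  \<open>a, c, a + c\<close> and \<open>d, b, d + b\<close>.\<close>

lemma phase_square:
  assumes "(a, b, c, d) \<in> frames"
  shows "\<phi> a c * \<phi> d b * \<phi> (a + c) (d + b) = - (\<phi> a d * \<phi> c b * \<phi> (a + d) (c + b))"
proof -
  have "\<phi> a c * \<phi> d b * \<phi> (a + c) (d + b) = \<phi> a c * \<phi> (a + c) d * \<phi> (a + c + d) b"
    using cocycle[of "a + c" d b] by simp
  also have "\<dots> = \<phi> c d * \<phi> a (c + d) * \<phi> (a + d + c) b"
    using cocycle[of a c d] by (simp add: ac_simps)
  also have "\<dots> = - (\<phi> d c * \<phi> a (d + c)) * \<phi> (a + d + c) b"
    using assms phase_swap[of c d] by (simp add: frames_def ac_simps)
  also have "\<dots> = - (\<phi> a d * \<phi> (a + d) c * \<phi> (a + d + c) b)"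
    using cocycle[of a d c] by simp
  also have "\<dots> = - (\<phi> a d * \<phi> c b * \<phi> (a + d) (c + b))"
    using cocycle[of "a + d" c b] by simp
  finally show ?thesis .
qed

text \<open>\<open>f\<close> marks the points of value -1. The left side of the outer
  \<open>\<noteq>\<close> is the sign of the product of the three values, the right side the sign of
  the line.\<close>

definition violated :: "('v \<Rightarrow> bool) \<Rightarrow> 'v \<Rightarrow> 'v \<Rightarrow> bool" where
  "violated f a c \<longleftrightarrow> ((f a \<noteq> (f c \<noteq> f (a + c))) \<noteq> (\<phi> a c = - 1))"

lemma violated_commute: "\<not> \<omega> a c \<Longrightarrow> violated f a c \<longleftrightarrow> violated f c a"
  using phase_commute[of a c] by (auto simp: violated_def add.commute)

lemma violated_add_right: "\<not> \<omega> a c \<Longrightarrow> violated f a (a + c) \<longleftrightarrow> violated f a c"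
  by (simp add: violated_def phase_add_right double_left) blast

lemma mermin_square:
  assumes "(a, b, c, d) \<in> frames"
  shows "violated f a c \<or> violated f d b \<or> violated f (a + c) (d + b) \<or>
    violated f a d \<or> violated f c b \<or> violated f (a + d) (c + b)"
proof (rule ccontr)
  define \<sigma> where "\<sigma> x = (if f x then - 1 else 1 :: complex)" for x
  have \<sigma>: "\<sigma> x * \<sigma> x = 1" "\<sigma> x * (\<sigma> x * z) = z" "\<sigma> x \<noteq> 0" for x z
    by (auto simp: \<sigma>_def)
  have \<phi>: "\<phi> x y = \<sigma> x * \<sigma> y * \<sigma> (x + y)" if "\<not> \<omega> x y" "\<not> violated f x y" for x y
    using that phase_real[of x y] by (auto simp: violated_def \<sigma>_def)
  assume neg: "\<not> ?thesis"
  have orth: "\<not> \<omega> a c" "\<not> \<omega> d b" "\<not> \<omega> (a + c) (d + b)" "\<not> \<omega> a d" "\<not> \<omega> c b" "\<not> \<omega> (a + d) (c + b)"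
    using frameD[OF assms] by (simp_all add: \<omega>_simps)
  have sat: "\<not> violated f a c" "\<not> violated f d b" "\<not> violated f (a + c) (d + b)"
    "\<not> violated f a d" "\<not> violated f c b" "\<not> violated f (a + d) (c + b)"
    using neg by simp_all
  \<comment> \<open>In either triple of lines the intermediate points \<open>a + c\<close>,
    \<open>d + b\<close> or \<open>a + d\<close>, \<open>c + b\<close> occur twice and cancel, so
    both triples give the same product of values.\<close>
  let ?r = "\<sigma> a * \<sigma> b * \<sigma> c * \<sigma> d * \<sigma> (a + b + c + d)"
  have "\<phi> a c * \<phi> d b * \<phi> (a + c) (d + b) = ?r"
    unfolding \<phi>[OF orth(1) sat(1)] \<phi>[OF orth(2) sat(2)] \<phi>[OF orth(3) sat(3)]
    by (simp add: \<sigma> ac_simps)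
  moreover have "\<phi> a d * \<phi> c b * \<phi> (a + d) (c + b) = ?r"
    unfolding \<phi>[OF orth(4) sat(4)] \<phi>[OF orth(5) sat(5)] \<phi>[OF orth(6) sat(6)]
    by (simp add: \<sigma> ac_simps)
  ultimately have "?r = - ?r" using phase_square[OF assms] by metis
  then show False using \<sigma>(3) by simp
qed

lemma violated_third: "\<not> \<omega> x y \<Longrightarrow> x + y = z \<Longrightarrow> violated f x z \<longleftrightarrow> violated f x y"
  using violated_add_right by blast

text \<open>The fifteen lines spanned by a frame form a doily. Each lies in four of its ten Mermin squares,
  and each square has a violated line, so at least \<open>10 / 4\<close> and hence three lines are violated.\<close>

lemma doily_violations:
  fixes f :: "'v \<Rightarrow> bool"
  defines "v \<equiv> \<lambda>x y. of_bool (violated f x y) :: nat"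
  assumes "(a, b, c, d) \<in> frames"
  shows "3 \<le> v a c + v a d + v a (c + d) + v b c + v b d
      + v b (c + d) + v (a + b) c + v (a + b) d + v (a + b) (c + d)
      + v (a + c) (b + d) + v (a + c) (b + (c + d)) + v (a + d) (b + c)
      + v (a + d) (b + (c + d)) + v (a + (c + d)) (b + c) + v (a + (c + d)) (b + d)"
proof -
  have commute: "v x y = v y x" if "\<not> \<omega> x y" for x y
    using violated_commute[OF that] by (simp add: v_def)
  have third: "v x z = v x y" if "\<not> \<omega> x y" "x + y = z" for x y z
    using violated_third[OF that] by (simp add: v_def)
  have square: "1 \<le> v p q + v p' q' + v p q' + v p' q + v (p + q) (p' + q') + v (p + q') (p' + q)"
    if "(p, p', q, q') \<in> frames" for p p' q q'
    using mermin_square[OF that, of f] frameD[OF that]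
    by (auto simp: v_def violated_commute[of q' p'] violated_commute[of q p'] violated_commute[of "p' + q'"] \<omega>_simps add.commute)
  \<comment> \<open>The points outside the two hyperbolic lines are the nine sums of a point of
    \<open>{a, b, a + b}\<close> and one of \<open>{c, d, c + d}\<close>. Nine of the Mermin squares
    come from choosing two points in each of these triples: three choices here for a given
    \<open>(q, q')\<close>, and three choices of \<open>(q, q')\<close> later.\<close>
  have squares: "1 \<le> v a q + v b q' + v a q' + v b q + v (a + q) (b + q') + v (a + q') (b + q)"
    "1 \<le> v a q + v (a + b) q' + v a q' + v (a + b) q + v (a + q) (b + (q + q')) + v (a + q') (b + (q + q'))"
    "1 \<le> v b q + v (a + b) q' + v b q' + v (a + b) q + v (a + (q + q')) (b + q) + v (a + (q + q')) (b + q')"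
    if "(a, b, q, q') \<in> frames" for q q'
  proof -
    note D = frameD[OF that]
    show "1 \<le> v a q + v b q' + v a q' + v b q + v (a + q) (b + q') + v (a + q') (b + q)"
      using square[OF that] .
    \<comment> \<open>The same line is named here by another pair of its points; such identities
      bring every term to the pair used for that line in the statement.\<close>
    have "v (a + q) (a + b + q') = v (a + q) (b + (q + q'))"
      "v (a + q') (a + b + q) = v (a + q') (b + (q + q'))"
      by (rule third; use D in \<open>simp add: \<omega>_simps char2_simps\<close>)+
    moreover have "(a, a + b, q, q') \<in> frames"
      by (rule frameI) (use D in \<open>simp_all add: \<omega>_simps\<close>)
    ultimately show "1 \<le> v a q + v (a + b) q' + v a q' + v (a + b) q + v (a + q) (b + (q + q')) + v (a + q') (b + (q + q'))"
      using square[of a "a + b" q q'] by simp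
    have "v (b + q) (a + b + q') = v (a + (q + q')) (b + q)"
      "v (b + q') (a + b + q) = v (a + (q + q')) (b + q')"
      by (subst commute; (subst third)?; use D in \<open>simp add: \<omega>_simps char2_simps\<close>)+
    moreover have "(b, a + b, q, q') \<in> frames"
      by (rule frameI) (use D in \<open>simp_all add: \<omega>_simps\<close>)
    ultimately show "1 \<le> v b q + v (a + b) q' + v b q' + v (a + b) q + v (a + (q + q')) (b + q) + v (a + (q + q')) (b + q')"
      using square[of b "a + b" q q'] by simp
  qed
  note D = frameD[OF assms(2)]
  have "(a, b, c, c + d) \<in> frames" "(a, b, d, c + d) \<in> frames"
    by (rule frameI; use D in \<open>simp add: \<omega>_simps\<close>)+
  note nine = squares[OF assms(2)] squares[OF this(1)] squares[OF this(2)]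
  have cd: "c + (c + d) = d" "d + (c + d) = c"
    by (simp_all add: char2_simps)
  \<comment> \<open>The tenth square consists of the nine sums; its lines are the six that miss both
    hyperbolic lines.\<close>
  have "(a + c, a + b + c, b + d, b + (c + d)) \<in> frames"
    by (rule frameI) (use D in \<open>simp_all add: \<omega>_simps\<close>)
  note ten = square[OF this]
  have "v (a + b + c) (b + (c + d)) = v (a + d) (b + (c + d))"
    by (subst (1 2) commute, use D in \<open>simp add: \<omega>_simps\<close>, use D in \<open>simp add: \<omega>_simps\<close>,
        rule third) (use D in \<open>simp_all add: \<omega>_simps char2_simps\<close>)
  moreover have "v (a + b + c) (b + d) = v (a + (c + d)) (b + d)"
    by (subst (1 2) commute, use D in \<open>simp add: \<omega>_simps\<close>, use D in \<open>simp add: \<omega>_simps\<close>,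
        rule third) (use D in \<open>simp_all add: \<omega>_simps char2_simps\<close>)
  moreover have "v (a + c + (b + d)) (a + b + c + (b + (c + d))) = v (a + d) (b + c)"
    "v (a + c + (b + (c + d))) (a + b + c + (b + d)) = v (a + (c + d)) (b + c)"
  proof -
    have "a + b + c + (b + (c + d)) = a + d" "a + b + c + (b + d) = a + (c + d)"
      by (simp_all add: char2_simps)
    moreover have "v (a + c + (b + d)) (a + d) = v (a + d) (a + c + (b + d))"
      "v (a + c + (b + (c + d))) (a + (c + d)) = v (a + (c + d)) (a + c + (b + (c + d)))"
      by (rule commute; use D in \<open>simp add: \<omega>_simps\<close>)+
    moreover have "v (a + d) (a + c + (b + d)) = v (a + d) (b + c)"
      "v (a + (c + d)) (a + c + (b + (c + d))) = v (a + (c + d)) (b + c)"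
      by (rule third; use D in \<open>simp add: \<omega>_simps char2_simps\<close>)+
    ultimately show "v (a + c + (b + d)) (a + b + c + (b + (c + d))) = v (a + d) (b + c)"
      "v (a + c + (b + (c + d))) (a + b + c + (b + d)) = v (a + (c + d)) (b + c)"
      by metis+
  qed
  ultimately show ?thesis using nine ten unfolding cd by linarith
qed

text \<open>For the pair \<open>(p, q)\<close> naming each line, \<open>p'\<close> and
  \<open>q'\<close> are chosen so that \<open>(p, p', q, q')\<close> is again a frame and determines
  \<open>(a, b, c, d)\<close>. Each of the fifteen sums therefore equals the one for
  \<open>(a, c)\<close>.\<close>

lemma sum_doily_lines:
  fixes v :: "'v \<Rightarrow> 'v \<Rightarrow> nat"
  shows "(\<Sum>(a, b, c, d)\<in>frames. v a c + v a d + v a (c + d) + v b c + v b d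
      + v b (c + d) + v (a + b) c + v (a + b) d + v (a + b) (c + d)
      + v (a + c) (b + d) + v (a + c) (b + (c + d)) + v (a + d) (b + c)
      + v (a + d) (b + (c + d)) + v (a + (c + d)) (b + c) + v (a + (c + d)) (b + d)) =
    15 * (\<Sum>(a, b, c, d)\<in>frames. v a c)"
proof -
  have "(\<Sum>(a, b, c, d)\<in>frames. v a c) = (\<Sum>(a, b, c, d)\<in>frames. v a c)"
    by (rule sum_frames_transform[where p' = "\<lambda>a b c d. b" and q' = "\<lambda>a b c d. d"])
      (auto simp: inj_def \<omega>_simps intro!: frameI dest: frameD)
  moreover have "(\<Sum>(a, b, c, d)\<in>frames. v a d) = (\<Sum>(a, b, c, d)\<in>frames. v a c)"
    by (rule sum_frames_transform[where p' = "\<lambda>a b c d. b" and q' = "\<lambda>a b c d. c"])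
      (auto simp: inj_def \<omega>_simps intro!: frameI dest: frameD)
  moreover have "(\<Sum>(a, b, c, d)\<in>frames. v a (c + d)) = (\<Sum>(a, b, c, d)\<in>frames. v a c)"
    by (rule sum_frames_transform[where p' = "\<lambda>a b c d. b" and q' = "\<lambda>a b c d. c"])
      (auto simp: inj_def \<omega>_simps intro!: frameI dest: frameD)
  moreover have "(\<Sum>(a, b, c, d)\<in>frames. v b c) = (\<Sum>(a, b, c, d)\<in>frames. v a c)"
    by (rule sum_frames_transform[where p' = "\<lambda>a b c d. a" and q' = "\<lambda>a b c d. d"])
      (auto simp: inj_def \<omega>_simps intro!: frameI dest: frameD)
  moreover have "(\<Sum>(a, b, c, d)\<in>frames. v b d) = (\<Sum>(a, b, c, d)\<in>frames. v a c)"
    by (rule sum_frames_transform[where p' = "\<lambda>a b c d. a" and q' = "\<lambda>a b c d. c"])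
      (auto simp: inj_def \<omega>_simps intro!: frameI dest: frameD)
  moreover have "(\<Sum>(a, b, c, d)\<in>frames. v b (c + d)) = (\<Sum>(a, b, c, d)\<in>frames. v a c)"
    by (rule sum_frames_transform[where p' = "\<lambda>a b c d. a" and q' = "\<lambda>a b c d. c"])
      (auto simp: inj_def \<omega>_simps intro!: frameI dest: frameD)
  moreover have "(\<Sum>(a, b, c, d)\<in>frames. v (a + b) c) = (\<Sum>(a, b, c, d)\<in>frames. v a c)"
    by (rule sum_frames_transform[where p' = "\<lambda>a b c d. a" and q' = "\<lambda>a b c d. d"])
      (auto simp: inj_def \<omega>_simps intro!: frameI dest: frameD)
  moreover have "(\<Sum>(a, b, c, d)\<in>frames. v (a + b) d) = (\<Sum>(a, b, c, d)\<in>frames. v a c)"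
    by (rule sum_frames_transform[where p' = "\<lambda>a b c d. a" and q' = "\<lambda>a b c d. c"])
      (auto simp: inj_def \<omega>_simps intro!: frameI dest: frameD)
  moreover have "(\<Sum>(a, b, c, d)\<in>frames. v (a + b) (c + d)) = (\<Sum>(a, b, c, d)\<in>frames. v a c)"
    by (rule sum_frames_transform[where p' = "\<lambda>a b c d. a" and q' = "\<lambda>a b c d. c"])
      (auto simp: inj_def \<omega>_simps intro!: frameI dest: frameD)
  moreover have "(\<Sum>(a, b, c, d)\<in>frames. v (a + c) (b + d)) = (\<Sum>(a, b, c, d)\<in>frames. v a c)"
    by (rule sum_frames_transform[where p' = "\<lambda>a b c d. b" and q' = "\<lambda>a b c d. c"])
      (auto simp: inj_def \<omega>_simps intro!: frameI dest: frameD)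
  moreover have "(\<Sum>(a, b, c, d)\<in>frames. v (a + c) (b + (c + d))) = (\<Sum>(a, b, c, d)\<in>frames. v a c)"
    by (rule sum_frames_transform[where p' = "\<lambda>a b c d. b" and q' = "\<lambda>a b c d. c"])
      (auto simp: inj_def \<omega>_simps intro!: frameI dest: frameD)
  moreover have "(\<Sum>(a, b, c, d)\<in>frames. v (a + d) (b + c)) = (\<Sum>(a, b, c, d)\<in>frames. v a c)"
    by (rule sum_frames_transform[where p' = "\<lambda>a b c d. b" and q' = "\<lambda>a b c d. d"])
      (auto simp: inj_def \<omega>_simps intro!: frameI dest: frameD)
  moreover have "(\<Sum>(a, b, c, d)\<in>frames. v (a + d) (b + (c + d))) = (\<Sum>(a, b, c, d)\<in>frames. v a c)"
    by (rule sum_frames_transform[where p' = "\<lambda>a b c d. b" and q' = "\<lambda>a b c d. d"])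
      (auto simp: inj_def \<omega>_simps intro!: frameI dest: frameD)
  moreover have "(\<Sum>(a, b, c, d)\<in>frames. v (a + (c + d)) (b + c)) = (\<Sum>(a, b, c, d)\<in>frames. v a c)"
    by (rule sum_frames_transform[where p' = "\<lambda>a b c d. b" and q' = "\<lambda>a b c d. c + d"])
      (auto simp: inj_def \<omega>_simps intro!: frameI dest: frameD)
  moreover have "(\<Sum>(a, b, c, d)\<in>frames. v (a + (c + d)) (b + d)) = (\<Sum>(a, b, c, d)\<in>frames. v a c)"
    by (rule sum_frames_transform[where p' = "\<lambda>a b c d. b" and q' = "\<lambda>a b c d. c + d"])
      (auto simp: inj_def \<omega>_simps intro!: frameI dest: frameD)
  ultimately show ?thesis
    by (simp add: case_prod_unfold sum.distrib)
qed

text \<open>Three violations among fifteen lines hold for every frame; since all orthogonal pairs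
  have equally many frames over them, the ratio carries over to the pairs. The constant function 3
  in \<open>sum_over_frames\<close> relates the number of frames to the number of pairs.\<close>

lemma five_violated_lines:
  "card orthogonal_pairs \<le> 5 * card {(a, c) \<in> orthogonal_pairs. violated f a c}"
proof -
  let ?v = "\<lambda>a c. of_bool (violated f a c) :: nat"
  let ?q = "(card (UNIV :: 'v set))\<^sup>2"
  have "?q * (3 * card orthogonal_pairs) = 32 * (3 * card frames)"
    using sum_over_frames[of "\<lambda>_ _. 3"] by (simp add: case_prod_unfold)
  also have "3 * card frames = (\<Sum>(a, b, c, d)\<in>frames. 3)"
    by (simp add: case_prod_unfold)
  also have "\<dots> \<le> 15 * (\<Sum>(a, b, c, d)\<in>frames. ?v a c)"
    unfolding sum_doily_lines[symmetric] by (rule sum_mono) (use doily_violations[of _ _ _ _ f] in auto)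
  also have "32 * (15 * (\<Sum>(a, b, c, d)\<in>frames. ?v a c)) = ?q * (15 * (\<Sum>(a, c)\<in>orthogonal_pairs. ?v a c))"
    using sum_over_frames[of ?v] by simp
  also have "(\<Sum>(a, c)\<in>orthogonal_pairs. ?v a c) = card {(a, c) \<in> orthogonal_pairs. violated f a c}"
    by (simp add: case_prod_unfold sum.inter_filter[symmetric] of_bool_def)
  finally show ?thesis by (simp add: finite_UNIV_card_ge_0)
qed

end

section \<open>Three-letter Pauli words\<close>

datatype letter = PI | PX | PY | PZ

text \<open>The Klein four-group, that is, multiplication of Pauli matrices up to phase.\<close>

instantiation letter :: ab_group_add
begin

fun plus_letter where
  "PI + q = q" | "p + PI = p" |
  "PX + PX = PI" | "PX + PY = PZ" | "PX + PZ = PY" |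
  "PY + PX = PZ" | "PY + PY = PI" | "PY + PZ = PX" |
  "PZ + PX = PY" | "PZ + PY = PX" | "PZ + PZ = PI"

definition zero_letter where "0 = PI"
definition uminus_letter where "- p = (p :: letter)"
definition minus_letter where "p - q = (p :: letter) + q"

instance
proof
  fix p q r :: letter
  show "p + q + r = p + (q + r)" by (cases p; cases q; cases r) simp_all
  show "p + q = q + p" by (cases p; cases q) simp_all
  show "0 + p = p" "- p + p = 0" by (cases p; simp add: zero_letter_def uminus_letter_def)+
  show "p - q = p + - q" by (simp add: uminus_letter_def minus_letter_def)
qed

end

lemma UNIV_letter: "UNIV = {PI, PX, PY, PZ}"
  using letter.exhaust by blast

instance letter :: finite
  by standard (simp add: UNIV_letter)

type_synonym word = "letter \<times> letter \<times> letter"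

fun anticommute :: "letter \<Rightarrow> letter \<Rightarrow> bool" where
  "anticommute PI q = False" | "anticommute p PI = False" |
  "anticommute PX PX = False" | "anticommute PY PY = False" | "anticommute PZ PZ = False" |
  "anticommute p q = True"

fun cyclic :: "letter \<Rightarrow> letter \<Rightarrow> bool" where
  "cyclic PX PY = True" | "cyclic PY PZ = True" | "cyclic PZ PX = True" | "cyclic p q = False"

text \<open>\<open>XY = \<i>Z\<close>, \<open>YZ = \<i>X\<close> and \<open>ZX = \<i>Y\<close>; reversing the factors negates the phase.\<close>

definition letter_phase :: "letter \<Rightarrow> letter \<Rightarrow> complex" where
  "letter_phase p q = (if cyclic p q then \<i> else if cyclic q p then - \<i> else 1)"

fun word_form :: "word \<Rightarrow> word \<Rightarrow> bool" where
  "word_form (p, q, r) (p', q', r') \<longleftrightarrow>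
     anticommute p p' \<noteq> (anticommute q q' \<noteq> anticommute r r')"

fun word_phase :: "word \<Rightarrow> word \<Rightarrow> complex" where
  "word_phase (p, q, r) (p', q', r') = letter_phase p p' * letter_phase q q' * letter_phase r r'"

lemma anticommute_add: "anticommute (p + q) r \<longleftrightarrow> anticommute p r \<noteq> anticommute q r"
  by (cases p; cases q; cases r) simp_all

lemma anticommute_commute: "anticommute p q \<longleftrightarrow> anticommute q p"
  by (cases p; cases q) simp_all

lemma anticommute_self: "\<not> anticommute p p"
  by (cases p) simp_all

lemma anticommute_0: "\<not> anticommute p 0"
  by (cases p) (simp_all add: zero_letter_def)

lemma anticommute_nondegenerate: "p \<noteq> 0 \<Longrightarrow> \<exists>q. anticommute p q"
  using anticommute.simps by (cases p) (fastforce simp: zero_letter_def)+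

lemma letter_phase_cocycle:
  "letter_phase p q * letter_phase (p + q) r = letter_phase q r * letter_phase p (q + r)"
  by (cases p; cases q; cases r) (simp_all add: letter_phase_def)

lemma letter_phase_swap:
  "letter_phase p q = (if anticommute p q then - 1 else 1) * letter_phase q p"
  by (cases p; cases q) (simp_all add: letter_phase_def)

lemma letter_phase_self: "letter_phase p p = 1"
  by (cases p) (simp_all add: letter_phase_def)

lemma letter_phase_0: "letter_phase 0 p = 1"
  by (cases p) (simp_all add: letter_phase_def zero_letter_def)

lemma letter_double: "p + p = (0 :: letter)"
  by (cases p) (simp_all add: zero_letter_def)

text \<open>Separates the positions that contribute a factor \<open>\<plusminus>\<i>\<close> from
  those contributing 1, so that a word phase can be read off from its anticommuting
  positions.\<close>

lemma letter_phase_cases: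
  "letter_phase p q = (if anticommute p q then if cyclic q p then - \<i> else \<i> else 1)"
  by (cases p; cases q) (simp_all add: letter_phase_def)

lemma zero_word: "(0 :: word) = (0, 0, 0)"
  by (simp add: zero_prod_def)

interpretation pauli_phase word_form word_phase
proof
  fix x y z :: word
  obtain p q r where x: "x = (p, q, r)" using prod_cases3 .
  obtain p' q' r' where y: "y = (p', q', r')" using prod_cases3 .
  obtain p'' q'' r'' where z: "z = (p'', q'', r'')" using prod_cases3 .
  show "x + x = 0" by (simp add: x zero_word letter_double)
  show "word_form x y \<longleftrightarrow> word_form y x"
    by (simp add: x y anticommute_commute[of p'] anticommute_commute[of q'] anticommute_commute[of r'])
  show "word_form (x + y) z \<longleftrightarrow> word_form x z \<noteq> word_form y z"
    by (auto simp: x y z anticommute_add)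
  show "\<not> word_form x x"
    by (simp add: x anticommute_self)
  show "\<exists>y. word_form x y" if "x \<noteq> 0"
  proof -
    from that have "p \<noteq> 0 \<or> q \<noteq> 0 \<or> r \<noteq> 0" by (auto simp: x zero_word)
    \<comment> \<open>A test word supported at one nonzero position of \<open>x\<close>
      suffices.\<close>
    then obtain u where "word_form x (u, 0, 0) \<or> word_form x (0, u, 0) \<or> word_form x (0, 0, u)"
      using anticommute_nondegenerate unfolding x by (force simp: anticommute_0)
    then show ?thesis by blast
  qed
  show "word_phase x y * word_phase (x + y) z = word_phase y z * word_phase x (y + z)"
  proof -
    have "word_phase x y * word_phase (x + y) z =
        (letter_phase p p' * letter_phase (p + p') p'') * (letter_phase q q' * letter_phase (q + q') q'')
        * (letter_phase r r' * letter_phase (r + r') r'')"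
      by (simp add: x y z)
    then show ?thesis
      by (simp add: letter_phase_cocycle x y z)
  qed
  show "word_phase x y = (if word_form x y then - 1 else 1) * word_phase y x"
    by (simp add: x y letter_phase_swap[of p p'] letter_phase_swap[of q q'] letter_phase_swap[of r r'])
  show "word_phase x x = 1"
    by (simp add: x letter_phase_self)
  show "word_phase 0 x = 1"
    by (simp add: x zero_word letter_phase_0)
  show "word_phase x y = 1 \<or> word_phase x y = - 1" if "\<not> word_form x y"
    using that by (auto simp: x y letter_phase_cases)
qed

text \<open>In a commuting pair either no or two positions anticommute, and two of them contribute
  \<open>\<plusminus>\<i>\<close> each.\<close>

fun word_negative :: "word \<Rightarrow> word \<Rightarrow> bool" where
  "word_negative (p, q, r) (p', q', r') \<longleftrightarrow> (anticommute p p' \<or> anticommute q q') \<noteq>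
    (cyclic p' p \<noteq> (cyclic q' q \<noteq> cyclic r' r))"

text \<open>If two positions anticommute, one of them is among the first two. Then
  \<open>\<i> * \<i>\<close> gives one sign and every pair in reversed cyclic order another; the
  result is a purely boolean test that can be evaluated.\<close>

lemma word_phase_negative:
  assumes "\<not> word_form x y"
  shows "word_phase x y = - 1 \<longleftrightarrow> word_negative x y"
proof -
  obtain p q r where x: "x = (p, q, r)" using prod_cases3 .
  obtain p' q' r' where y: "y = (p', q', r')" using prod_cases3 .
  have "\<not> anticommute p q \<Longrightarrow> \<not> cyclic q p" for p q
    by (cases p; cases q) simp_all
  then show ?thesis
    using assms by (auto simp: x y letter_phase_cases)
qed

text \<open>\<open>XXX\<close>, \<open>YYY\<close>, \<open>ZZZ\<close> and the six permutations of \<open>XYZ\<close>: giving exactly these observables the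
  value \<open>-1\<close> violates three lines through every point, so \<open>63\<close> in total. Found by computer search.\<close>

fun nine_words :: "word \<Rightarrow> bool" where
  "nine_words (PI, q, r) = False" | "nine_words (p, PI, r) = False" | "nine_words (p, q, PI) = False" |
  "nine_words (p, q, r) = ((p = q) = (q = r) \<and> (q = r) = (p = r))"

definition words :: "word list" where
  "words = List.product [PI, PX, PY, PZ] (List.product [PI, PX, PY, PZ] [PI, PX, PY, PZ])"

lemma set_words: "set words = UNIV"
  by (simp add: words_def UNIV_letter[symmetric] del: List.product.simps)

text \<open>Three violated lines through \<open>a\<close> correspond to six choices of
  \<open>c\<close>. The list \<open>words\<close> starts with the identity word, which
  \<open>tl\<close> drops.\<close>

lemma violated_nine_words:
  "list_all (\<lambda>a. length (filter (\<lambda>c. a \<noteq> (PI, PI, PI) \<and> c \<noteq> (PI, PI, PI) \<and> a \<noteq> c \<and> \<not> word_form a c \<and>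
    ((nine_words a \<noteq> (nine_words c \<noteq> nine_words (a + c))) \<noteq> word_negative a c)) words) \<le> 6) (tl words)"
  by code_simp

section \<open>Observables of words\<close>

lemma dim_kronecker [simp]:
  "dim_row (kronecker A B) = dim_row A * dim_row B" "dim_col (kronecker A B) = dim_col A * dim_col B"
  by (simp_all add: kronecker_def)

text \<open>Division with remainder by \<open>m\<close> identifies the indices below
  \<open>n * m\<close> with pairs of indices.\<close>

lemma sum_product_index:
  fixes f g :: "nat \<Rightarrow> 'a::comm_semiring_0"
  shows "(\<Sum>k<n * m. f (k div m) * g (k mod m)) = (\<Sum>i<n. f i) * (\<Sum>j<m. g j)"
proof (cases "m = 0")
  case False
  have "(\<Sum>k<n * m. f (k div m) * g (k mod m)) = (\<Sum>(i, j)\<in>{..<n} \<times> {..<m}. f i * g j)"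
  proof (rule sum.reindex_bij_witness[of _ "\<lambda>(i, j). i * m + j" "\<lambda>k. (k div m, k mod m)"])
    fix p assume "p \<in> {..<n} \<times> {..<m}"
    then obtain i j where p: "p = (i, j)" "i < n" "j < m" by auto
    then have "i * m + j < Suc i * m" by simp
    also have "\<dots> \<le> n * m" using p by (intro mult_right_mono) auto
    finally show "(case p of (i, j) \<Rightarrow> i * m + j) \<in> {..<n * m}" by (simp add: p)
  qed (use False in \<open>auto simp: less_mult_imp_div_less\<close>)
  then show ?thesis by (simp add: sum_product sum.cartesian_product)
qed simp

text \<open>The mixed-product rule: the summation index splits into quotient and remainder, and the
  sum factors accordingly.\<close>

lemma kronecker_mult:
  assumes "A \<in> carrier_mat n n" "B \<in> carrier_mat m m" "C \<in> carrier_mat n n" "D \<in> carrier_mat m m"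
  shows "kronecker A B * kronecker C D = kronecker (A * C) (B * D)"
proof (rule eq_matI)
  fix i j assume "i < dim_row (kronecker (A * C) (B * D))" "j < dim_col (kronecker (A * C) (B * D))"
  then have ij: "i < n * m" "j < n * m" using assms by auto
  then have m: "0 < m" by (cases m) auto
  have dm: "i div m < n" "j div m < n" "i mod m < m" "j mod m < m"
    using ij m by (auto simp: less_mult_imp_div_less)
  have "(kronecker A B * kronecker C D) $$ (i, j) = (\<Sum>k<n * m. kronecker A B $$ (i, k) * kronecker C D $$ (k, j))"
    using assms ij by (simp add: scalar_prod_def lessThan_atLeast0)
  also have "\<dots> = (\<Sum>k<n * m. (A $$ (i div m, k div m) * C $$ (k div m, j div m)) *
      (B $$ (i mod m, k mod m) * D $$ (k mod m, j mod m)))"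
    using assms ij by (intro sum.cong) (auto simp: kronecker_def)
  also have "\<dots> = (A * C) $$ (i div m, j div m) * (B * D) $$ (i mod m, j mod m)"
    using assms dm
      sum_product_index[where f = "\<lambda>k. A $$ (i div m, k) * C $$ (k, j div m)"
        and g = "\<lambda>k. B $$ (i mod m, k) * D $$ (k, j mod m)" and n = n and m = m]
    by (simp add: scalar_prod_def lessThan_atLeast0)
  also have "\<dots> = kronecker (A * C) (B * D) $$ (i, j)"
    using assms ij by (simp add: kronecker_def)
  finally show "(kronecker A B * kronecker C D) $$ (i, j) = kronecker (A * C) (B * D) $$ (i, j)" .
qed (use assms in auto)

lemma kronecker_smult: "kronecker (a \<cdot>\<^sub>m A) (b \<cdot>\<^sub>m B) = (a * b) \<cdot>\<^sub>m kronecker A B"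
proof (rule eq_matI)
  fix i j assume "i < dim_row ((a * b) \<cdot>\<^sub>m kronecker A B)" "j < dim_col ((a * b) \<cdot>\<^sub>m kronecker A B)"
  then have ij: "i < dim_row A * dim_row B" "j < dim_col A * dim_col B" by auto
  then have "0 < dim_row B" "0 < dim_col B" by (auto intro: Nat.gr0I)
  with ij show "kronecker (a \<cdot>\<^sub>m A) (b \<cdot>\<^sub>m B) $$ (i, j) = ((a * b) \<cdot>\<^sub>m kronecker A B) $$ (i, j)"
    by (simp add: kronecker_def less_mult_imp_div_less)
qed auto

lemma kronecker_one: "kronecker (1\<^sub>m n) (1\<^sub>m m) = 1\<^sub>m (n * m)"
proof (rule eq_matI)
  fix i j assume "i < dim_row (1\<^sub>m (n * m) :: complex mat)" "j < dim_col (1\<^sub>m (n * m) :: complex mat)"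
  then have ij: "i < n * m" "j < n * m" by auto
  then have "0 < m" by (cases m) auto
  moreover have "i = j \<longleftrightarrow> i div m = j div m \<and> i mod m = j mod m"
    by (metis div_mult_mod_eq)
  ultimately show "kronecker (1\<^sub>m n) (1\<^sub>m m) $$ (i, j) = 1\<^sub>m (n * m) $$ (i, j)"
    using ij by (auto simp: kronecker_def less_mult_imp_div_less)
qed auto

section \<open>Letters as matrices and words as tensor products\<close>

fun z_part :: "letter \<Rightarrow> bit" where
  "z_part PI = 0" | "z_part PX = 0" | "z_part PY = 1" | "z_part PZ = 1"

fun x_part :: "letter \<Rightarrow> bit" where
  "x_part PI = 0" | "x_part PX = 1" | "x_part PY = 1" | "x_part PZ = 0"

definition letter_mat :: "letter \<Rightarrow> complex mat" where
  "letter_mat p = pauli (z_part p) (x_part p)"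

lemma letter_mat_carrier [simp]: "letter_mat p \<in> carrier_mat 2 2"
  by (cases p) (simp_all add: letter_mat_def pauli_def pauli_X_def pauli_Y_def pauli_Z_def mat_of_rows_list_def numeral_2_eq_2)

lemma letter_mat_mult: "letter_mat p * letter_mat q = letter_phase p q \<cdot>\<^sub>m letter_mat (p + q)"
proof (rule eq_matI)
  fix i j
  assume "i < dim_row (letter_phase p q \<cdot>\<^sub>m letter_mat (p + q))"
    "j < dim_col (letter_phase p q \<cdot>\<^sub>m letter_mat (p + q))"
  then have "i < 2" "j < 2" using letter_mat_carrier[of "p + q"] by (auto simp del: letter_mat_carrier)
  then show "(letter_mat p * letter_mat q) $$ (i, j) = (letter_phase p q \<cdot>\<^sub>m letter_mat (p + q)) $$ (i, j)"
    by (cases p; cases q) (auto simp: less_2_cases_iff letter_mat_def letter_phase_def pauli_def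
        pauli_X_def pauli_Y_def pauli_Z_def mat_of_rows_list_def scalar_prod_def)
qed (use letter_mat_carrier in \<open>metis carrier_matD index_mult_mat(2,3) index_smult_mat(2,3)\<close>)+

text \<open>The three coordinates \<open>g $ j\<close> come first and the three coordinates
  \<open>g $ (j + 3)\<close> after them, matching the argument order of
  \<open>pauli\<close>.\<close>

fun vec_of_word :: "word \<Rightarrow> bit vec" where
  "vec_of_word (p, q, r) =
     vec 6 (\<lambda>i. [z_part p, z_part q, z_part r, x_part p, x_part q, x_part r] ! i)"

definition observable :: "word \<Rightarrow> complex mat" where
  "observable w = observable_of 3 (vec_of_word w)"

lemma observable_eq:
  "observable (p, q, r) = kronecker (letter_mat p) (kronecker (letter_mat q) (kronecker (letter_mat r) (1\<^sub>m 1)))"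
  by (simp add: observable_def observable_of_def kronecker_list_def letter_mat_def upt_rec)

lemma kronecker_carrier [simp]:
  "A \<in> carrier_mat n n \<Longrightarrow> B \<in> carrier_mat m m \<Longrightarrow> kronecker A B \<in> carrier_mat (n * m) (n * m)"
  by (metis carrier_matD carrier_matI dim_kronecker)

lemma observable_carrier [simp]: "observable w \<in> carrier_mat 8 8"
proof (cases w)
  case (fields p q r)
  have "kronecker (letter_mat r) (1\<^sub>m 1) \<in> carrier_mat (2 * 1) (2 * 1)"
    by (intro kronecker_carrier) auto
  then have "observable w \<in> carrier_mat (2 * (2 * (2 * 1))) (2 * (2 * (2 * 1)))"
    unfolding fields observable_eq by (intro kronecker_carrier) auto
  then show ?thesis by simp
qed

lemma observable_mult: "observable a * observable b = word_phase a b \<cdot>\<^sub>m observable (a + b)"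
proof -
  obtain p q r where a: "a = (p, q, r)" using prod_cases3 .
  obtain p' q' r' where b: "b = (p', q', r')" using prod_cases3 .
  have r: "kronecker (letter_mat r) (1\<^sub>m 1) \<in> carrier_mat (2 * 1) (2 * 1)" for r
    by (intro kronecker_carrier) auto
  have qr: "kronecker (letter_mat q) (kronecker (letter_mat r) (1\<^sub>m 1)) \<in> carrier_mat (2 * (2 * 1)) (2 * (2 * 1))" for q r
    by (intro kronecker_carrier) (use r in auto)
  \<comment> \<open>The trailing factor \<open>1\<^sub>m 1\<close> comes from the initial value of
    \<open>foldr\<close>; a scalar in front of it lets \<open>kronecker_smult\<close> apply at the
    innermost level too.\<close>
  have one: "1\<^sub>m 1 * 1\<^sub>m 1 = 1 \<cdot>\<^sub>m (1\<^sub>m 1 :: complex mat)"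
    by (intro eq_matI) auto
  show ?thesis
    unfolding a b observable_eq kronecker_mult[OF letter_mat_carrier qr letter_mat_carrier qr]
      kronecker_mult[OF letter_mat_carrier r letter_mat_carrier r]
      kronecker_mult[OF letter_mat_carrier one_carrier_mat letter_mat_carrier one_carrier_mat]
      letter_mat_mult one kronecker_smult add_Pair
    by (simp add: ac_simps observable_eq)
qed

lemma observable_0: "observable 0 = 1\<^sub>m 8"
proof -
  have "letter_mat PI = 1\<^sub>m 2" by (simp add: letter_mat_def pauli_def)
  then show ?thesis by (simp add: zero_word zero_letter_def observable_eq kronecker_one)
qed

lemma observable_square: "observable a * observable a = 1\<^sub>m 8"
  unfolding observable_mult phase_self double observable_0 by (intro eq_matI) auto

lemma smult_one_mat_eq_iff:
  assumes "0 < n"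
  shows "a \<cdot>\<^sub>m 1\<^sub>m n = (b \<cdot>\<^sub>m 1\<^sub>m n :: complex mat) \<longleftrightarrow> a = b"
proof
  assume "a \<cdot>\<^sub>m 1\<^sub>m n = (b \<cdot>\<^sub>m 1\<^sub>m n :: complex mat)"
  then have "(a \<cdot>\<^sub>m 1\<^sub>m n) $$ (0, 0) = (b \<cdot>\<^sub>m 1\<^sub>m n :: complex mat) $$ (0, 0)" by simp
  then show "a = b" using assms by simp
qed simp

lemma observable_swap:
  "observable a * observable b = (if word_form a b then - 1 else 1) \<cdot>\<^sub>m (observable b * observable a)"
  unfolding observable_mult phase_swap[of a b] by (auto simp: add.commute intro!: eq_matI)

text \<open>Equal observables anticommute with the same observables, so the form does not separate their
  words.\<close>

lemma inj_observable: "inj observable"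
proof (rule injI, rule ccontr)
  fix a b assume eq: "observable a = observable b" and "a \<noteq> b"
  then obtain c where "word_form (a + b) c"
    using nondegenerate by (metis add_eq_0_iff_eq)
  then have "word_form c a \<noteq> word_form c b"
    using \<omega>_add_left \<omega>_commute by blast
  moreover have "(if word_form c a then - 1 else 1) \<cdot>\<^sub>m (observable a * observable c) =
      (if word_form c b then - 1 else 1) \<cdot>\<^sub>m (observable a * observable c)"
    using observable_swap[of c a] observable_swap[of c b] eq by metis
  \<comment> \<open>\<open>observable c * observable a\<close> is the inverse of
    \<open>observable a * observable c\<close>; multiplying by it leaves only the two scalars to
    compare.\<close>
  then have "((if word_form c a then - 1 else 1) \<cdot>\<^sub>m (observable a * observable c)) * (observable c * observable a) =
      ((if word_form c b then - 1 else 1) \<cdot>\<^sub>m (observable a * observable c)) * (observable c * observable a)"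
    by simp
  moreover have "(observable a * observable c) * (observable c * observable a) = 1\<^sub>m 8"
  proof -
    have "(observable a * observable c) * (observable c * observable a) =
        observable a * ((observable c * observable c) * observable a)"
      by (simp add: assoc_mult_mat[of _ 8 8 _ 8 _ 8] mult_carrier_mat[of _ 8 8 _ 8])
    then show ?thesis by (simp add: observable_square left_mult_one_mat[of _ 8 8])
  qed
  ultimately have "((if word_form c a then - 1 else 1) :: complex) = (if word_form c b then - 1 else 1)"
    by (simp add: smult_one_mat_eq_iff mult_smult_assoc_mat[of _ 8 8 _ 8] mult_carrier_mat[of _ 8 8 _ 8])
  with \<open>word_form c a \<noteq> word_form c b\<close> show False by (auto split: if_splits)
qed

lemma observable_eq_iff: "observable a = observable b \<longleftrightarrow> a = b"
  using inj_observable by (auto dest: injD)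

section \<open>Products along a line and its sign\<close>

lemma foldr_observables:
  assumes "p + q = r"
  shows "foldr (*) [observable p, observable q, observable r] (1\<^sub>m 8) = word_phase p q \<cdot>\<^sub>m 1\<^sub>m 8"
proof -
  have "foldr (*) [observable p, observable q, observable r] (1\<^sub>m 8) =
      (observable p * observable q) * observable r"
    by (simp add: assoc_mult_mat[of _ 8 8 _ 8 _ 8] right_mult_one_mat[of _ 8 8])
  \<comment> \<open>The product of the first two observables is a multiple of the third, which then
    squares to the identity.\<close>
  also have "\<dots> = word_phase p q \<cdot>\<^sub>m (observable r * observable r)"
    unfolding observable_mult[of p q] assms by (simp add: mult_smult_assoc_mat[of _ 8 8 _ 8])
  finally show ?thesis by (simp add: observable_square)
qed

text \<open>In each of the six enumerations the third point is the sum of the first two, and all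
  ordered pairs on the line have the same phase.\<close>

lemma line_has_product:
  assumes "(a, c) \<in> orthogonal_pairs"
  shows "has_product 3 (observable ` {a, c, a + c}) P \<longleftrightarrow> P = word_phase a c \<cdot>\<^sub>m 1\<^sub>m 8"
proof -
  note ne = orthogonal_pairsD[OF assms]
  have prod: "foldr (*) Ms (1\<^sub>m 8) = word_phase a c \<cdot>\<^sub>m 1\<^sub>m 8"
    if Ms: "distinct Ms" "set Ms = observable ` {a, c, a + c}" for Ms
  proof -
    have "length Ms = card (observable ` {a, c, a + c})"
      using Ms distinct_card by metis
    also have "\<dots> = 3"
      using ne by (subst card_image[OF inj_on_subset[OF inj_observable]]) auto
    finally obtain A B C where ABC: "Ms = [A, B, C]"
      by (auto simp: numeral_3_eq_3 length_Suc_conv)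
    then have "A \<in> observable ` {a, c, a + c}" "B \<in> observable ` {a, c, a + c}" "C \<in> observable ` {a, c, a + c}"
      unfolding Ms(2)[symmetric] by simp_all
    then obtain p q r where pqr: "A = observable p" "B = observable q" "C = observable r"
      "p \<in> {a, c, a + c}" "q \<in> {a, c, a + c}" "r \<in> {a, c, a + c}"
      by (elim imageE)
    with Ms(1) have d: "p \<noteq> q" "p \<noteq> r" "q \<noteq> r" unfolding ABC by auto
    have c1: "word_phase c a = word_phase a c" using phase_commute ne by blast
    have c2: "word_phase a (a + c) = word_phase a c" using phase_add_right ne by blast
    have c3: "word_phase c (a + c) = word_phase a c" using phase_add_right[of c a] ne c1 by (simp add: add.commute)
    have "\<not> word_form a (a + c)" "\<not> word_form c (a + c)" using ne by (simp_all add: \<omega>_simps)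
    then have c4: "word_phase (a + c) a = word_phase a c" "word_phase (a + c) c = word_phase a c"
      using c2 c3 by (metis phase_commute)+
    have "(p, q, r) \<in> {(a, c, a + c), (c, a, a + c), (a, a + c, c), (a + c, a, c), (c, a + c, a), (a + c, c, a)}"
      using pqr(4-6) d by blast
    then have "p + q = r" by (auto simp: char2_simps)
    moreover have "word_phase p q = word_phase a c"
      using \<open>(p, q, r) \<in> _\<close> c1 c2 c3 c4 by blast
    ultimately show ?thesis using foldr_observables[of p q r] by (simp add: ABC pqr)
  qed
  \<comment> \<open>An enumeration exists, so the universal statement in \<open>has_product\<close>
    is not vacuous and determines \<open>P\<close>.\<close>
  have "distinct [observable a, observable c, observable (a + c)]"
    using ne by (auto simp: observable_eq_iff)
  moreover have "set [observable a, observable c, observable (a + c)] = observable ` {a, c, a + c}"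
    by simp
  ultimately have ex: "\<exists>Ms. distinct Ms \<and> set Ms = observable ` {a, c, a + c}"
    by blast
  have "(2 :: nat) ^ 3 = 8" by simp
  then show ?thesis
    unfolding has_product_def using prod ex by (metis finite.emptyI finite.insertI finite_imageI)
qed

lemma line_negative_context:
  assumes "(a, c) \<in> orthogonal_pairs"
  shows "negative_context 3 (observable ` {a, c, a + c}) \<longleftrightarrow> word_phase a c = - 1"
proof -
  have "- 1\<^sub>m (2 ^ 3) = (- 1 \<cdot>\<^sub>m 1\<^sub>m 8 :: complex mat)" by (intro eq_matI) auto
  then show ?thesis
    unfolding negative_context_def line_has_product[OF assms] by (auto simp: smult_one_mat_eq_iff)
qed

lemma line_positive_context:
  assumes "(a, c) \<in> orthogonal_pairs"
  shows "positive_context 3 (observable ` {a, c, a + c}) \<longleftrightarrow> word_phase a c = 1"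
proof -
  have "1\<^sub>m (2 ^ 3) = (1 \<cdot>\<^sub>m 1\<^sub>m 8 :: complex mat)" by (intro eq_matI) auto
  then show ?thesis
    unfolding positive_context_def line_has_product[OF assms] by (metis smult_one_mat_eq_iff[of 8] zero_less_numeral)
qed

section \<open>Words as vectors: the points and lines of the polar space\<close>

lemma vec_of_word_carrier: "vec_of_word w \<in> carrier_vec 6"
  by (cases w) simp

lemma letter_eqI: "z_part p = z_part q \<Longrightarrow> x_part p = x_part q \<Longrightarrow> p = q"
  by (cases p; cases q) simp_all

lemma ex_letter: "\<exists>p. z_part p = u \<and> x_part p = v"
proof -
  have "z_part PI = 0 \<and> x_part PI = 0" "z_part PX = 0 \<and> x_part PX = 1"
    "z_part PZ = 1 \<and> x_part PZ = 0" "z_part PY = 1 \<and> x_part PY = 1" by simp_all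
  then show ?thesis by (cases u; cases v) blast+
qed

lemma all_less_6: "(\<forall>i<6. P i) \<longleftrightarrow> P 0 \<and> P 1 \<and> P 2 \<and> P 3 \<and> P 4 \<and> P (5 :: nat)"
  by (simp add: numeral_eq_Suc All_less_Suc conj_ac)

lemma bij_vec_of_word: "bij_betw vec_of_word UNIV (carrier_vec 6)"
proof -
  have "w = w'" if "vec_of_word w = vec_of_word w'" for w w'
  proof -
    obtain p q r where w: "w = (p, q, r)" using prod_cases3 .
    obtain p' q' r' where w': "w' = (p', q', r')" using prod_cases3 .
    have "\<forall>i<6. vec_of_word w $ i = vec_of_word w' $ i" using that by simp
    then show ?thesis unfolding all_less_6 w w' by (auto intro: letter_eqI)
  qed
  moreover have "\<exists>w. v = vec_of_word w" if v: "v \<in> carrier_vec 6" for v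
  proof -
    obtain p q r where "z_part p = v $ 0" "x_part p = v $ 3" "z_part q = v $ 1" "x_part q = v $ 4"
      "z_part r = v $ 2" "x_part r = v $ 5"
      using ex_letter by meson
    then have "\<forall>i<6. v $ i = vec_of_word (p, q, r) $ i" unfolding all_less_6 by simp
    then have "v = vec_of_word (p, q, r)" using v by (intro eq_vecI) auto
    then show ?thesis by blast
  qed
  ultimately show ?thesis 
    using vec_of_word_carrier unfolding bij_betw_def inj_def by blast
qed

lemma vec_of_word_eq_iff: "vec_of_word a = vec_of_word b \<longleftrightarrow> a = b"
  using bij_vec_of_word by (auto simp: bij_betw_def dest: injD)

lemma vec_of_word_0: "vec_of_word 0 = 0\<^sub>v 6"
proof (rule eq_vecI)
  fix i :: nat assume "i < dim_vec (0\<^sub>v 6 :: bit vec)"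
  moreover have "\<forall>i<6. vec_of_word 0 $ i = 0\<^sub>v 6 $ i"
    unfolding all_less_6 by (simp add: zero_word zero_letter_def)
  ultimately show "vec_of_word 0 $ i = 0\<^sub>v 6 $ i" by simp
qed (simp add: zero_word)

lemma letter_parts_add: "z_part (p + q) = z_part p + z_part q" "x_part (p + q) = x_part p + x_part q"
  by (cases p; cases q; simp)+

lemma vec_of_word_add: "vec_of_word (a + b) = vec_of_word a + vec_of_word b"
proof (rule eq_vecI)
  have dim: "dim_vec (vec_of_word w) = 6" for w
    using vec_of_word_carrier[of w] by (rule carrier_vecD)
  obtain p q r where a: "a = (p, q, r)" using prod_cases3 .
  obtain p' q' r' where b: "b = (p', q', r')" using prod_cases3 .
  fix i assume "i < dim_vec (vec_of_word a + vec_of_word b)"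
  then have "i < 6" using dim by simp
  moreover have "\<forall>i<6. vec_of_word (a + b) $ i = (vec_of_word a + vec_of_word b) $ i"
    unfolding all_less_6 by (simp add: a b letter_parts_add del: add_bit_eq_xor)
  ultimately show "vec_of_word (a + b) $ i = (vec_of_word a + vec_of_word b) $ i" by blast
qed (use vec_of_word_carrier in \<open>metis carrier_vecD index_add_vec(2)\<close>)

lemma anticommute_parts:
  "(of_bool (anticommute p q) :: bit) = z_part p * x_part q + x_part p * z_part q"
  by (cases p; cases q) simp_all

text \<open>Each position contributes one summand of the form, and the sum in \<open>bit\<close> is
  the parity of the number of anticommuting positions.\<close>

lemma symp_form_vec_of_word: "symp_form 3 (vec_of_word a) (vec_of_word b) = of_bool (word_form a b)"
proof -
  obtain p q r where a: "a = (p, q, r)" using prod_cases3 .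
  obtain p' q' r' where b: "b = (p', q', r')" using prod_cases3 .
  have "symp_form 3 (vec_of_word a) (vec_of_word b) =
      of_bool (anticommute p p') + of_bool (anticommute q q') + of_bool (anticommute r r')"
    unfolding anticommute_parts by (simp add: symp_form_def a b numeral_3_eq_3 del: add_bit_eq_xor mult_bit_eq_and)
  also have "\<dots> = of_bool (word_form a b)"
    by (auto simp: a b)
  finally show ?thesis .
qed

lemma W_points_3: "W_points 3 = vec_of_word ` (UNIV - {0})"
proof -
  have "carrier_vec 6 = range vec_of_word" using bij_vec_of_word by (simp add: bij_betw_def)
  moreover have "2 * 3 = (6 :: nat)" by simp
  ultimately have "W_points 3 = {v \<in> range vec_of_word. v \<noteq> vec_of_word 0}"
    unfolding W_points_def vec_of_word_0 by metis
  then show ?thesis using vec_of_word_eq_iff by blast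
qed

lemma W_lines_3: "W_lines 3 = (\<lambda>l. vec_of_word ` l) ` lines"
proof -
  have "l \<in> W_lines 3 \<longleftrightarrow> l \<in> (\<lambda>l. vec_of_word ` l) ` lines" for l
  proof -
    have "l \<in> W_lines 3 \<longleftrightarrow> (\<exists>a c. a \<noteq> 0 \<and> c \<noteq> 0 \<and> vec_of_word a \<noteq> vec_of_word c \<and>
        symp_form 3 (vec_of_word a) (vec_of_word c) = 0 \<and>
        l = {vec_of_word a, vec_of_word c, vec_of_word a + vec_of_word c})"
      unfolding W_lines_def W_points_3 by blast
    also have "\<dots> \<longleftrightarrow> (\<exists>a c. (a, c) \<in> orthogonal_pairs \<and> l = vec_of_word ` {a, c, a + c})"
      unfolding vec_of_word_eq_iff symp_form_vec_of_word orthogonal_pairs_def image_insert image_empty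
        vec_of_word_add by (simp del: vec_of_word.simps split_paired_Ex)
    also have "\<dots> \<longleftrightarrow> l \<in> (\<lambda>l. vec_of_word ` l) ` lines"
      unfolding image_iff bex_lines_iff ..
    finally show ?thesis .
  qed
  then show ?thesis by blast
qed

lemma W_observables_3: "W_observables 3 = observable ` (UNIV - {0})"
  by (simp add: W_observables_def W_points_3 image_image observable_def)

lemma W_contexts_3: "W_contexts 3 = (\<lambda>l. observable ` l) ` lines"
  by (simp add: W_contexts_def W_lines_3 image_image observable_def)

lemma card_UNIV_word: "card (UNIV :: word set) = 64"
  by (simp add: card_cartesian_product UNIV_letter flip: UNIV_Times_UNIV)

text \<open>1890 is \<open>63 * 60 / 2\<close>; division by the six ordered pairs on each line then
  gives 315 lines.\<close>

lemma card_orthogonal_words: "card (orthogonal_pairs :: (word \<times> word) set) = 1890"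
  using card_orthogonal_pairs by (simp add: card_UNIV_word)

lemma card_lines: "card lines = 315"
  using card_orthogonal_pairs_filter[of "\<lambda>_. True"] by (simp add: card_orthogonal_words)

section \<open>The configuration of all points and lines\<close>

lemma inj_on_image_sets: "inj f \<Longrightarrow> inj_on (\<lambda>l. f ` l) L"
  by (simp add: inj_on_def inj_image_eq_iff)

lemma incidence_map_line:
  assumes "(a, c) \<in> orthogonal_pairs"
  shows "incidence_map (W_observables 3) (W_contexts 3) x (observable ` {a, c, a + c}) =
    x (observable a) + x (observable c) + x (observable (a + c))"
proof -
  note ne = orthogonal_pairsD[OF assms]
  let ?c = "observable ` {a, c, a + c}"
  have "?c \<in> W_contexts 3"
    using assms unfolding W_contexts_3 image_iff bex_lines_iff by blast
  moreover have sub: "?c \<subseteq> W_observables 3" using ne unfolding W_observables_3 by blast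
  moreover have fin: "finite (W_observables 3)" unfolding W_observables_3 by simp
  ultimately have "incidence_map (W_observables 3) (W_contexts 3) x ?c =
      (\<Sum>M\<in>W_observables 3. incidence_matrix ?c M * x M)"
    unfolding incidence_map_def by simp
  also have "\<dots> = (\<Sum>M\<in>?c. x M)"
    by (rule sum.mono_neutral_cong_right[OF fin sub]) (auto simp: incidence_matrix_def)
  also have "\<dots> = (\<Sum>w\<in>{a, c, a + c}. x (observable w))"
    by (rule sum.reindex[OF inj_on_subset[OF inj_observable subset_UNIV], unfolded comp_def])
  also have "\<dots> = x (observable a) + x (observable c) + x (observable (a + c))"
    using ne by (simp add: add.assoc del: add_bit_eq_xor)
  finally show ?thesis .
qed

lemma valuation_line:
  assumes "(a, c) \<in> orthogonal_pairs"
  shows "valuation_vector 3 (W_contexts 3) (observable ` {a, c, a + c}) = of_bool (word_phase a c = - 1)"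
proof -
  have "observable ` {a, c, a + c} \<in> W_contexts 3"
    using assms unfolding W_contexts_3 image_iff bex_lines_iff by blast
  then show ?thesis
    unfolding valuation_vector_def by (simp add: line_negative_context[OF assms] del: image_insert)
qed

text \<open>Translates an equation over the two-element field into the boolean shape of
  \<open>violated\<close>.\<close>

lemma bit_sum_neq_iff:
  "x + y + z \<noteq> of_bool b \<longleftrightarrow> ((x = 1) \<noteq> ((y = 1) \<noteq> (z = 1))) \<noteq> b" for x y z :: bit
  by (cases x; cases y; cases z; cases b) simp_all

text \<open>The rows where the valuation and the image vector differ are exactly the violated lines;
  the factor 6 passes from lines to ordered pairs.\<close>

lemma hamming_distance_words:
  "6 * hamming_distance (W_contexts 3) (valuation_vector 3 (W_contexts 3))
      (incidence_map (W_observables 3) (W_contexts 3) x) =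
    card {(a, c) \<in> orthogonal_pairs. violated (\<lambda>w. x (observable w) = 1) a c}"
proof -
  let ?E = "valuation_vector 3 (W_contexts 3)"
  let ?Ax = "incidence_map (W_observables 3) (W_contexts 3) x"
  let ?P = "\<lambda>l. ?E (observable ` l) \<noteq> ?Ax (observable ` l)"
  have "inj (\<lambda>l. observable ` l)" using inj_observable by (rule inj_on_image_sets)
  moreover have "{c \<in> W_contexts 3. ?E c \<noteq> ?Ax c} = (\<lambda>l. observable ` l) ` {l \<in> lines. ?P l}"
    unfolding W_contexts_3 by blast
  ultimately have "hamming_distance (W_contexts 3) ?E ?Ax = card {l \<in> lines. ?P l}"
    unfolding hamming_distance_def by (simp add: card_image inj_on_subset)
  then have "6 * hamming_distance (W_contexts 3) ?E ?Ax = card {(a, c) \<in> orthogonal_pairs. ?P {a, c, a + c}}"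
    unfolding card_orthogonal_pairs_filter[of ?P] by simp
  also have "?P {a, c, a + c} \<longleftrightarrow> violated (\<lambda>w. x (observable w) = 1) a c"
    if "(a, c) \<in> orthogonal_pairs" for a c
    unfolding valuation_line[OF that] incidence_map_line[OF that] violated_def bit_sum_neq_iff[symmetric]
    by (rule neq_commute)
  then have "{(a, c) \<in> orthogonal_pairs. ?P {a, c, a + c}} =
      {(a, c) \<in> orthogonal_pairs. violated (\<lambda>w. x (observable w) = 1) a c}"
    by blast
  finally show ?thesis .
qed

text \<open>378 is \<open>63 * 6\<close>: each nonzero \<open>a\<close> has at most six partners
  \<open>c\<close>.\<close>

lemma card_violated_nine_words:
  "card {(a, c) \<in> orthogonal_pairs. violated nine_words a c} \<le> 378"
proof -
  let ?V = "\<lambda>a. filter (\<lambda>c. a \<noteq> (PI, PI, PI) \<and> c \<noteq> (PI, PI, PI) \<and> a \<noteq> c \<and> \<not> word_form a c \<and>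
    ((nine_words a \<noteq> (nine_words c \<noteq> nine_words (a + c))) \<noteq> word_negative a c)) words"
  have zero: "(0 :: word) = (PI, PI, PI)" by (simp add: zero_word zero_letter_def)
  have le: "card (set (?V a)) \<le> 6" if "a \<noteq> 0" for a
  proof -
    have "a \<in> set (tl words)"
    proof -
      have "a \<in> set words" by (simp add: set_words)
      moreover have "words = 0 # tl words" by (simp add: words_def zero)
      ultimately show ?thesis using that by (metis set_ConsD)
    qed
    then have "length (?V a) \<le> 6" using violated_nine_words unfolding list_all_iff by blast
    then show ?thesis using card_length le_trans by blast
  qed
  \<comment> \<open>On orthogonal pairs the evaluated test agrees with \<open>violated\<close>,
    since \<open>word_negative\<close> replaces the comparison of complex phases.\<close>
  have "c \<in> set (?V a)" if "(a, c) \<in> orthogonal_pairs" "violated nine_words a c" for a c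
    using orthogonal_pairsD[OF that(1)] that(2) word_phase_negative[of a c]
    unfolding violated_def zero set_filter set_words by blast
  then have "{(a, c) \<in> orthogonal_pairs. violated nine_words a c} \<subseteq> (SIGMA a:UNIV - {0}. set (?V a))"
    using orthogonal_pairsD(1) by blast
  then have "card {(a, c) \<in> orthogonal_pairs. violated nine_words a c} \<le> card (SIGMA a:UNIV - {0}. set (?V a))"
    by (rule card_mono[rotated]) simp
  also have "\<dots> = (\<Sum>a\<in>UNIV - {0}. card (set (?V a)))"
    by (rule card_SigmaI) auto
  also have "\<dots> \<le> (\<Sum>a\<in>UNIV - {0 :: word}. 6)"
    by (rule sum_mono) (use le in blast)
  also have "\<dots> = 378" by (simp add: card_Diff_subset card_UNIV_word)
  finally show ?thesis .
qed

lemma W_quantum_configuration: "quantum_configuration 3 (W_observables 3) (W_contexts 3)"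
  unfolding quantum_configuration_def
proof (intro conjI ballI)
  show "W_observables 3 \<subseteq> qubit_observables 3"
    unfolding W_observables_def qubit_observables_def W_points_def by blast
  show "finite (W_observables 3)" "finite (W_contexts 3)"
    unfolding W_observables_3 W_contexts_3 by simp_all
  show "M * M = 1\<^sub>m (2 ^ 3)" if "M \<in> W_observables 3" for M
    using that unfolding W_observables_3 by (elim imageE) (simp add: observable_square)
  fix c assume "c \<in> W_contexts 3"
  then obtain a b where ab: "(a, b) \<in> orthogonal_pairs" and c: "c = observable ` {a, b, a + b}"
    unfolding W_contexts_3 image_iff bex_lines_iff by blast
  note ne = orthogonal_pairsD[OF ab]
  show "c \<subseteq> W_observables 3" using ne unfolding c W_observables_3 by blast
  show "positive_context 3 c \<or> negative_context 3 c"
    unfolding c line_positive_context[OF ab] line_negative_context[OF ab] using phase_real[OF ne(4)] .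
  fix M M' assume "M \<in> c" "M' \<in> c"
  then obtain u v where uv: "M = observable u" "M' = observable v"
    "u \<in> {a, b, a + b}" "v \<in> {a, b, a + b}"
    unfolding c by blast
  have "\<not> word_form u v"
    using uv(3,4) ne by (elim insertE emptyE) (simp_all add: \<omega>_simps)
  then have "word_phase u v = word_phase v u" by (rule phase_commute)
  then show "M * M' = M' * M"
    unfolding uv observable_mult[of u v] observable_mult[of v u] by (simp only: add.commute)
qed

theorem mainTheorem4:
  shows "card (W_points 3) = 63 \<and> card (W_lines 3) = 315 \<and>
    card (W_observables 3) = 63 \<and> card (W_contexts 3) = 315 \<and>
    quantum_configuration 3 (W_observables 3) (W_contexts 3) \<and>
    contextual 3 (W_observables 3) (W_contexts 3) \<and>
    contextuality_degree 3 (W_observables 3) (W_contexts 3) = 63"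
proof (intro conjI)
  let ?Obs = "W_observables 3" and ?C = "W_contexts 3"
  let ?h = "\<lambda>x. hamming_distance ?C (valuation_vector 3 ?C) (incidence_map ?Obs ?C x)"
  have inj_vec: "inj vec_of_word" using bij_vec_of_word by (simp add: bij_betw_def)
  have "card (UNIV - {0 :: word}) = 63" by (simp add: card_Diff_subset card_UNIV_word)
  then show "card (W_points 3) = 63" "card ?Obs = 63"
    unfolding W_points_3 W_observables_3
    by (simp_all add: card_image inj_on_subset[OF inj_vec] inj_on_subset[OF inj_observable])
  show "card (W_lines 3) = 315" "card ?C = 315"
    unfolding W_lines_3 W_contexts_3
    by (simp_all add: card_image card_lines inj_on_image_sets inj_vec inj_observable)
  show "quantum_configuration 3 ?Obs ?C" by (rule W_quantum_configuration)
  \<comment> \<open>The inequality reads \<open>1890 \<le> 5 * (6 * ?h x)\<close>, and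
    \<open>1890 = 30 * 63\<close>.\<close>
  have lower: "63 \<le> ?h x" for x
    using five_violated_lines[of "\<lambda>w. x (observable w) = 1"]
    unfolding hamming_distance_words[symmetric] card_orthogonal_words by simp
  show "contextual 3 ?Obs ?C"
    unfolding contextual_def
  proof (intro notI, elim bexE)
    fix x assume "incidence_map ?Obs ?C x = valuation_vector 3 ?C"
    then have "?h x = 0" by (simp add: hamming_distance_def)
    with lower[of x] show False by simp
  qed
  \<comment> \<open>The marking of the nine words is carried over to matrices along the inverse of
    \<open>observable\<close>; restriction to \<open>?Obs\<close> makes it an element of the
    extensional function space.\<close>
  define x where "x = (\<lambda>M\<in>?Obs. of_bool (nine_words (inv_into UNIV observable M)) :: bit)"
  have "violated (\<lambda>w. x (observable w) = 1) a c \<longleftrightarrow> violated nine_words a c"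
    if "(a, c) \<in> orthogonal_pairs" for a c
  proof -
    have "x (observable w) = of_bool (nine_words w)" if "w \<noteq> 0" for w
      using that unfolding x_def W_observables_3 by (simp add: inv_f_f[OF inj_observable])
    then show ?thesis using orthogonal_pairsD[OF that] unfolding violated_def by simp
  qed
  then have "{(a, c) \<in> orthogonal_pairs. violated (\<lambda>w. x (observable w) = 1) a c} =
      {(a, c) \<in> orthogonal_pairs. violated nine_words a c}"
    by blast
  \<comment> \<open>The bound 378 on violated ordered pairs is \<open>6 * 63\<close>, which meets
    the lower bound.\<close>
  then have "6 * ?h x \<le> 6 * 63"
    unfolding hamming_distance_words using card_violated_nine_words by simp
  with lower[of x] have "?h x = 63" by simp
  moreover have "x \<in> ?Obs \<rightarrow>\<^sub>E UNIV" by (simp add: x_def)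
  ultimately show "contextuality_degree 3 ?Obs ?C = 63"
    unfolding contextuality_degree_def by (intro Least_equality) (use lower in auto)
qed

end
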